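(* Let $g\colon\mathbb{R}^d\to\mathbb{R}$ be a function for which there exist reals $\rho,\mu>0$ such that: (1) the function $g+\frac{\rho}{2}\|\cdot\|^2$ is convex; (2) the set $\mathcal{X}$ of minimizers of $g$ is nonempty and $g(x)-\min g\ge\mu\cdot\mathrm{dist}(x;\mathcal{X})$ for all $x\in\mathbb{R}^d$. Then $g$ has no stationary points $x$ satisfying $$0<\mathrm{dist}(x;\mathcal{X})<\frac{2\mu}{\rho}.$$
   Context: $\|\cdot\|$ is the Euclidean norm and $\mathrm{dist}(x;\mathcal{X})=\inf_{y\in\mathcal{X}}\|y-x\|$. A point $x$ is stationary for $g$ if $0\in\partial g(x)$, where $\partial g$ is the limiting subdifferential: the Fréchet subdifferential $\hat\partial g(x)$ is the set of $v$ with $g(y)\ge g(x)+\langle v,y-x\rangle+o(\|y-x\|)$ as $y\to x$, and $\partial g(x)$ is the set of limits of vectors $v_i\in\hat\partial g(x_i)$ with $x_i\to x$, $g(x_i)\to g(x)$. *)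

theory Defs
  imports "HOL-Analysis.Analysis" "HOL-Library.Landau_Symbols"
begin

definition minimizers :: "('a \<Rightarrow> real) \<Rightarrow> 'a set" where
  "minimizers g = {x. \<forall>y. g x \<le> g y}"

text \<open>The function \<open>r\<close> is the \<open>o(\<parallel>y - x\<parallel>)\<close> term. The filter \<open>at x\<close> excludes the point
  \<open>y = x\<close>, where the inequality carries no information.\<close>

definition frechet_subdifferential :: "('a::real_inner \<Rightarrow> real) \<Rightarrow> 'a \<Rightarrow> 'a set" where
  "frechet_subdifferential g x =
     {v. \<exists>r. r \<in> o[at x](\<lambda>y. norm (y - x)) \<and>
             (\<forall>\<^sub>F y in at x. g y \<ge> g x + v \<bullet> (y - x) + r y)}"

definition limiting_subdifferential :: "('a::real_inner \<Rightarrow> real) \<Rightarrow> 'a \<Rightarrow> 'a set" where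
  "limiting_subdifferential g x =
     {v. \<exists>xs vs. xs \<longlonglongrightarrow> x \<and> (\<lambda>i. g (xs i)) \<longlonglongrightarrow> g x \<and>
                 (\<forall>i. vs i \<in> frechet_subdifferential g (xs i)) \<and> vs \<longlonglongrightarrow> v}"

definition stationary :: "('a::real_inner \<Rightarrow> real) \<Rightarrow> 'a \<Rightarrow> bool" where
  "stationary g x \<longleftrightarrow> 0 \<in> limiting_subdifferential g x"

end

theory Submission
  imports Defs
begin

text \<open>Weak convexity upgrades the local Frechet inequality to the global bound
  \<open>g y \<ge> g x + v \<bullet> (y - x) - \<rho>/2 \<parallel>y - x\<parallel>\<^sup>2\<close>, which passes to the limit and so holds for
  limiting subgradients. With \<open>v = 0\<close> and \<open>y\<close> running through near-projections of \<open>x\<close> onto the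
  minimizers, sharpness gives \<open>\<mu> d \<le> g x - min g \<le> \<rho>/2 d\<^sup>2\<close> for \<open>d = dist(x; \<X>)\<close>, so
  \<open>d = 0\<close> or \<open>d \<ge> 2 \<mu> / \<rho>\<close>.\<close>

text \<open>The last term is the exact convexity defect of the squared norm. It turns convexity of
  the perturbed function into an upper bound for \<open>g\<close> along segments.\<close>

lemma norm_convex_combination_squared:
  fixes x y :: "'a::real_inner"
  shows "(norm ((1 - t) *\<^sub>R x + t *\<^sub>R y))\<^sup>2
    = (1 - t) * (norm x)\<^sup>2 + t * (norm y)\<^sup>2 - t * (1 - t) * (norm (y - x))\<^sup>2"
  unfolding power2_norm_eq_inner inner_add_left inner_add_right inner_diff_left inner_diff_right
    inner_scaleR_left inner_scaleR_right
  by (simp add: inner_commute algebra_simps)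

text \<open>At a point of the segment from \<open>x\<close> to \<open>y\<close> close to
  \<open>x\<close>, the Frechet inequality bounds \<open>g\<close> from below and weak convexity
  bounds it from above. Comparing the two and cancelling the step length \<open>t\<close> carries
  the local information to \<open>y\<close>.\<close>

lemma weakly_convex_frechet_lower_bound:
  fixes g :: "'a::real_inner \<Rightarrow> real"
  assumes "\<rho> \<ge> 0"
    and convex: "convex_on UNIV (\<lambda>x. g x + \<rho> / 2 * (norm x)\<^sup>2)"
    and v: "v \<in> frechet_subdifferential g x"
  shows "g y \<ge> g x + v \<bullet> (y - x) - \<rho> / 2 * (norm (y - x))\<^sup>2"
proof (cases "y = x")
  case False
  define n where "n = norm (y - x)"
  have "n > 0" using False by (simp add: n_def)
  obtain r where r: "r \<in> o[at x](\<lambda>y. norm (y - x))"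
    and ev: "\<forall>\<^sub>F z in at x. g z \<ge> g x + v \<bullet> (z - x) + r z"
    using v by (auto simp: frechet_subdifferential_def)
  have bound: "g x + v \<bullet> (y - x) - \<rho> / 2 * n\<^sup>2 \<le> g y + e" if "e > 0" for e
  proof -
    \<comment> \<open>The slope \<open>e / n\<close> makes the error exactly \<open>t * e\<close> at
      the point at distance \<open>t * n\<close> from \<open>x\<close>.\<close>
    have "\<forall>\<^sub>F z in at x. norm (r z) \<le> e / n * norm (norm (z - x))"
      using landau_o.smallD[OF r, of "e / n"] \<open>e > 0\<close> \<open>n > 0\<close> by simp
    with ev have "\<forall>\<^sub>F z in at x. g z \<ge> g x + v \<bullet> (z - x) - e / n * norm (z - x)"
      by eventually_elim auto
    then obtain d where "d > 0"
      and d: "\<And>z. z \<noteq> x \<Longrightarrow> dist z x < d \<Longrightarrow> g z \<ge> g x + v \<bullet> (z - x) - e / n * norm (z - x)"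
      by (auto simp: eventually_at)
    \<comment> \<open>The first entry keeps \<open>t < 1\<close>; the second puts \<open>z\<close>
      within distance \<open>d\<close> of \<open>x\<close>.\<close>
    define t where "t = min (1/2) (d / (2 * n))"
    have t: "0 < t" "t < 1" using \<open>d > 0\<close> \<open>n > 0\<close> by (auto simp: t_def)
    have "t * n \<le> d / (2 * n) * n"
      using \<open>n > 0\<close> by (intro mult_right_mono) (auto simp: t_def)
    then have "t * n < d" using \<open>d > 0\<close> \<open>n > 0\<close> by simp
    define z where "z = (1 - t) *\<^sub>R x + t *\<^sub>R y"
    have zx: "z - x = t *\<^sub>R (y - x)" by (simp add: z_def algebra_simps)
    have nz: "norm (z - x) = t * n" using t by (simp add: zx n_def)
    have "z \<noteq> x" using nz t \<open>n > 0\<close> by auto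
    then have "g z \<ge> g x + v \<bullet> (z - x) - e / n * norm (z - x)"
      using d[of z] nz \<open>t * n < d\<close> by (simp add: dist_norm)
    then have lower: "g z \<ge> g x + t * (v \<bullet> (y - x)) - t * e"
      using \<open>n > 0\<close> by (simp only: nz) (simp add: zx mult.commute)
    have "g z + \<rho> / 2 * (norm z)\<^sup>2
        \<le> (1 - t) * (g x + \<rho> / 2 * (norm x)\<^sup>2) + t * (g y + \<rho> / 2 * (norm y)\<^sup>2)"
      using convex_onD[OF convex, of t x y] t by (simp add: z_def)
    then have "g z \<le> (1 - t) * g x + t * g y + \<rho> / 2 * (t * (1 - t) * n\<^sup>2)"
      unfolding z_def norm_convex_combination_squared n_def
      by (simp add: algebra_simps add_divide_distrib diff_divide_distrib)
    with lower have "t * (g x + v \<bullet> (y - x) - e) \<le> t * (g y + \<rho> / 2 * ((1 - t) * n\<^sup>2))"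
      by (simp add: algebra_simps)
    then have "g x + v \<bullet> (y - x) - e \<le> g y + \<rho> / 2 * ((1 - t) * n\<^sup>2)"
      using t by simp
    \<comment> \<open>Dropping the factor \<open>1 - t\<close> removes \<open>t\<close> from the
      bound, so one fixed \<open>t\<close> suffices for each \<open>e\<close>.\<close>
    moreover have "\<rho> / 2 * ((1 - t) * n\<^sup>2) \<le> \<rho> / 2 * n\<^sup>2"
      using t \<open>\<rho> \<ge> 0\<close> by (intro mult_left_mono mult_left_le_one_le) auto
    ultimately show ?thesis by linarith
  qed
  show ?thesis using field_le_epsilon[OF bound] by (simp add: n_def)
qed simp

text \<open>For fixed \<open>y\<close> the Frechet bound depends continuously on the base point, the
  value there and the subgradient, and all three converge by definition.\<close>

lemma weakly_convex_limiting_lower_bound: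
  fixes g :: "'a::real_inner \<Rightarrow> real"
  assumes "\<rho> \<ge> 0"
    and "convex_on UNIV (\<lambda>x. g x + \<rho> / 2 * (norm x)\<^sup>2)"
    and "v \<in> limiting_subdifferential g x"
  shows "g y \<ge> g x + v \<bullet> (y - x) - \<rho> / 2 * (norm (y - x))\<^sup>2"
proof -
  obtain xs vs where lim: "xs \<longlonglongrightarrow> x" "(\<lambda>i. g (xs i)) \<longlonglongrightarrow> g x" "vs \<longlonglongrightarrow> v"
    and vs: "\<And>i. vs i \<in> frechet_subdifferential g (xs i)"
    using assms(3) by (auto simp: limiting_subdifferential_def)
  have "(\<lambda>i. g (xs i) + vs i \<bullet> (y - xs i) - \<rho> / 2 * (norm (y - xs i))\<^sup>2)
      \<longlonglongrightarrow> g x + v \<bullet> (y - x) - \<rho> / 2 * (norm (y - x))\<^sup>2"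
    by (intro tendsto_intros lim)
  then show ?thesis
    by (rule LIMSEQ_le_const2)
      (use weakly_convex_frechet_lower_bound[OF assms(1,2) vs] in blast)
qed

lemma INF_eq_minimizer:
  assumes "y \<in> minimizers g"
  shows "(INF x. g x) = (g y :: real)"
  using assms by (intro cInf_eq_minimum) (auto simp: minimizers_def)

theorem lemma3p1:
  fixes g :: "real ^ 'd \<Rightarrow> real" and \<rho> \<mu> :: real
  assumes "\<rho> > 0" and "\<mu> > 0"
    and "convex_on UNIV (\<lambda>x. g x + \<rho> / 2 * (norm x)\<^sup>2)"
    and "minimizers g \<noteq> {}"
    and "\<And>x. g x - (INF y. g y) \<ge> \<mu> * infdist x (minimizers g)"
  shows "\<not> (\<exists>x. stationary g x \<and>
                0 < infdist x (minimizers g) \<and> infdist x (minimizers g) < 2 * \<mu> / \<rho>)"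
proof (rule notI, elim exE conjE)
  fix x
  define d where "d = infdist x (minimizers g)"
  assume "stationary g x" and "0 < infdist x (minimizers g)"
    and "infdist x (minimizers g) < 2 * \<mu> / \<rho>"
  then have stat: "0 \<in> limiting_subdifferential g x" and d: "0 < d" "d < 2 * \<mu> / \<rho>"
    by (simp_all add: stationary_def d_def)
  \<comment> \<open>The geometric mean of \<open>d\<close> and \<open>2 * \<mu> / \<rho>\<close>
    exceeds \<open>d\<close>, so some minimizer lies closer to \<open>x\<close> than that. This
    radius is the one at which the quadratic term equals \<open>\<mu> * d\<close>.\<close>
  have "d * d < d * (2 * \<mu> / \<rho>)" using d by (intro mult_strict_left_mono)
  then have "d < sqrt (d * (2 * \<mu> / \<rho>))"
    by (intro real_less_rsqrt) (simp add: power2_eq_square)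
  then obtain y where y: "y \<in> minimizers g" and "dist x y < sqrt (d * (2 * \<mu> / \<rho>))"
    using assms(4) by (auto simp: d_def infdist_def cINF_less_iff)
  then have "(norm (y - x))\<^sup>2 < (sqrt (d * (2 * \<mu> / \<rho>)))\<^sup>2"
    by (intro power_strict_mono) (auto simp: dist_norm norm_minus_commute)
  also have "\<dots> = d * (2 * \<mu> / \<rho>)" using d assms(1,2) by simp
  finally have "\<rho> / 2 * (norm (y - x))\<^sup>2 < \<mu> * d"
    using assms(1) by (simp add: field_simps)
  moreover have "g y \<ge> g x - \<rho> / 2 * (norm (y - x))\<^sup>2"
    using weakly_convex_limiting_lower_bound[OF _ assms(3) stat, of y] assms(1) by simp
  moreover have "\<mu> * d \<le> g x - g y"
    using assms(5)[of x] by (simp add: d_def INF_eq_minimizer[OF y])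
  ultimately show False by linarith
qed

end
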